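(* Let $d_h$ be the distance function associated with the Riemannian metric $h$ on $\mathbb{H}^+$. There exist constants $0<C_1\le C_2$ such that for all points $q_j=x_j+y_jI_j\in\mathbb{H}^+$, $j=1,2$, with $x_j>0$, $y_j\ge0$, $I_j\in\mathbb{S}$, setting $$E(q_1,q_2)=d_{hyp}(\pi(q_1),\pi(q_2))+\min\left\{\frac{y_j}{|q_j|}:\ j=1,2\right\}d_{\mathbb{S}}(I_1,I_2),$$ one has $$C_1\,E(q_1,q_2)\le d_h(q_1,q_2)\le C_2\,E(q_1,q_2).$$
   Context: $\mathbb{H}$ is the skew-field of quaternions, $\mathbb{H}^+=\{q\in\mathbb{H}:\mathrm{Re}(q)>0\}$, $\mathbb{S}=\{q\in\mathbb{H}:q^2=-1\}$, $L_I=\mathbb{R}+\mathbb{R}I$ for $I\in\mathbb{S}$. The Riemannian metric $h$ on $\mathbb{H}^+$ is given, for $u=x+yI_u\in\mathbb{H}^+$ and $v=v_1+v_2\in T_u\mathbb{H}^+\cong\mathbb{H}$ with $v_1\in L_{I_u}$, $v_2\in L_{I_u}^\perp$ (Euclidean orthogonal complement), by $$|v|^2_{h(u)}=\frac{1}{4\,\mathrm{Re}(u)^2}|v_1|^2+\frac{1}{4|u|^2}|v_2|^2.$$ (It is the pullback under $C^{-1}(q)=(1+q)^{-1}(q-1)$ of the metric $g$ on the unit ball given by $|d|^2_{g(w)}=\frac{|d_1|^2}{(1-|w|^2)^2}+\frac{|d_2|^2}{|1-w^2|^2}$, $d=d_1+d_2\in L_{I_w}+L_{I_w}^\perp$.)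 Fix an imaginary unit $I_0\in\mathbb{S}$. The projection $\pi$ is $\pi(x+yI)=x+yI_0$ for $x\in\mathbb{R}$, $y\ge0$, $I\in\mathbb{S}$. $d_{hyp}$ is the distance on $\mathbb{H}^+_{I_0}=\{x+yI_0:x>0,\ y\in\mathbb{R}\}$ associated with $ds^2_{hyp}=(dx^2+dy^2)/(4x^2)$, and $d_{\mathbb{S}}$ is the usual spherical distance on the unit two-sphere $\mathbb{S}$. *)

theory Defs
  imports "HOL-Analysis.Analysis"
begin

text \<open>A quaternion is the pair of its real part \<^term>\<open>fst q\<close> and its imaginary part
  \<^term>\<open>snd q\<close>, the latter with coordinates along the standard units i, j, k. The norm
  and inner product of the product type are the Euclidean ones of the quaternions.\<close>

type_synonym quat = "real \<times> (real ^ 3)"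

definition qone :: quat
  where "qone = (1, 0)"

definition qmult :: "quat \<Rightarrow> quat \<Rightarrow> quat"
  where "qmult p q =
    (fst p * fst q - snd p \<bullet> snd q, fst p *\<^sub>R snd q + fst q *\<^sub>R snd p + cross3 (snd p) (snd q))"

lemma qmult_qone [simp]: "qmult qone q = q" "qmult q qone = q"
  by (simp_all add: qmult_def qone_def cross_zero_left cross_zero_right)

lemma qmult_assoc: "qmult (qmult p q) r = qmult p (qmult q r)"
  by (cases p; cases q; cases r)
    (simp add: qmult_def cross3_def inner_vec_def sum_3 vec_eq_iff forall_3 vector_3 algebra_simps)

definition quat_half_space :: "quat set"
  where "quat_half_space = {q. fst q > 0}"

definition imag_units :: "quat set"
  where "imag_units = {q. qmult q q = - qone}"

definition qpoint :: "real \<Rightarrow> real \<Rightarrow> quat \<Rightarrow> quat"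
  where "qpoint x y I = x *\<^sub>R qone + y *\<^sub>R I"

definition slice :: "quat \<Rightarrow> quat set"
  where "slice I = {qpoint x y I | x y. True}"

definition slice_half_plane :: "quat \<Rightarrow> quat set"
  where "slice_half_plane I = {qpoint x y I | x y. x > 0}"

lemma imag_units_iff: "I \<in> imag_units \<longleftrightarrow> fst I = 0 \<and> norm (snd I) = 1"
proof
  assume "I \<in> imag_units"
  then have 1: "fst I * fst I - snd I \<bullet> snd I = -1" and 2: "fst I *\<^sub>R snd I + fst I *\<^sub>R snd I = 0"
    by (simp_all add: imag_units_def qmult_def qone_def)
  have "fst I = 0"
  proof (rule ccontr)
    assume "fst I \<noteq> 0"
    with 2 have "snd I = 0"
      by (simp flip: scaleR_2)
    with 1 have "fst I * fst I = -1" by simp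
    then show False using zero_le_square[of "fst I"] by linarith
  qed
  with 1 show "fst I = 0 \<and> norm (snd I) = 1"
    by (simp add: norm_eq_1)
next
  assume "fst I = 0 \<and> norm (snd I) = 1"
  then show "I \<in> imag_units"
    by (simp add: imag_units_def qmult_def qone_def norm_eq_1)
qed

text \<open>The distance on \<open>M\<close> of a metric whose value at a tangent vector \<open>v\<close> in \<open>u\<close> has
  length \<open>N u v\<close>: the infimum of the lengths of piecewise \<open>C\<^sup>1\<close> curves in \<open>M\<close>. Only curves for
  which the length integral exists are admitted: \<^const>\<open>piecewise_C1_differentiable_on\<close> does not
  bound the derivative near the break points, and \<^const>\<open>integral\<close> would give the length 0 to a
  curve of infinite length.\<close>

definition riem_dist :: "quat set \<Rightarrow> (quat \<Rightarrow> quat \<Rightarrow> real) \<Rightarrow> quat \<Rightarrow> quat \<Rightarrow> real"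
  where "riem_dist M N p q = Inf {l. \<exists>\<gamma>. \<gamma> piecewise_C1_differentiable_on {0..1} \<and>
    path_image \<gamma> \<subseteq> M \<and> pathstart \<gamma> = p \<and> pathfinish \<gamma> = q \<and>
    ((\<lambda>t. N (\<gamma> t) (vector_derivative \<gamma> (at t))) has_integral l) {0..1}}"

text \<open>At a real point \<open>u\<close> every unit \<open>I\<close> is admissible in the following definition; the value
  does not depend on the choice, see \<open>h_norm_sq_eq\<close> below.\<close>

definition h_norm_sq :: "quat \<Rightarrow> quat \<Rightarrow> real"
  where "h_norm_sq u v = (THE r. \<exists>x y I v1 v2. I \<in> imag_units \<and> y \<ge> 0 \<and> u = qpoint x y I \<and>
    v1 \<in> slice I \<and> v2 \<in> orthogonal_comp (slice I) \<and> v = v1 + v2 \<and>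
    r = 1 / (4 * (fst u)\<^sup>2) * (norm v1)\<^sup>2 + 1 / (4 * (norm u)\<^sup>2) * (norm v2)\<^sup>2)"

definition d_h :: "quat \<Rightarrow> quat \<Rightarrow> real"
  where "d_h = riem_dist quat_half_space (\<lambda>u v. sqrt (h_norm_sq u v))"

text \<open>In the slice of \<open>I\<close> the coordinates of a tangent vector \<open>v\<close> are \<open>dx = fst v\<close> and
  \<open>dy = v \<bullet> I\<close>.\<close>

definition d_hyp :: "quat \<Rightarrow> quat \<Rightarrow> quat \<Rightarrow> real"
  where "d_hyp I = riem_dist (slice_half_plane I)
    (\<lambda>u v. sqrt (((fst v)\<^sup>2 + (v \<bullet> I)\<^sup>2) / (4 * (fst u)\<^sup>2)))"

definition slice_proj :: "quat \<Rightarrow> quat \<Rightarrow> quat"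
  where "slice_proj I0 q = qpoint (fst q) (norm (snd q)) I0"

lemma slice_proj_qpoint:
  assumes "I \<in> imag_units" "y \<ge> 0"
  shows "slice_proj I0 (qpoint x y I) = qpoint x y I0"
  using assms by (simp add: slice_proj_def qpoint_def qone_def imag_units_iff)

definition d_sphere :: "quat \<Rightarrow> quat \<Rightarrow> real"
  where "d_sphere I J = arccos (I \<bullet> J)"

lemma slice_decomp:
  assumes I: "I \<in> imag_units" and v1: "v1 \<in> slice I" and v2: "v2 \<in> orthogonal_comp (slice I)"
    and v: "v = v1 + v2"
  shows "v1 = qpoint (fst v) (v \<bullet> I) I"
proof -
  obtain a b where ab: "v1 = qpoint a b I"
    using v1 by (auto simp: slice_def)
  have "qpoint 1 0 I \<in> slice I" "qpoint 0 1 I \<in> slice I"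
    by (auto simp: slice_def)
  with v2 have "qpoint 1 0 I \<bullet> v2 = 0" "qpoint 0 1 I \<bullet> v2 = 0"
    by (auto simp: orthogonal_comp_def orthogonal_def)
  then have o: "fst v2 = 0" "v2 \<bullet> I = 0"
    by (simp_all add: qpoint_def qone_def inner_prod_def inner_commute)
  have "I \<bullet> I = 1" "fst I = 0"
    using I by (simp_all add: imag_units_iff inner_prod_def norm_eq_1)
  then have "fst v = a" "v \<bullet> I = b"
    using o by (simp_all add: v ab qpoint_def qone_def inner_left_distrib)
      (simp add: inner_prod_def)
  with ab show ?thesis by simp
qed

lemma h_norm_sq_eq:
  fixes u v I :: quat and x y :: real
  assumes I: "I \<in> imag_units" and y: "y \<ge> 0" and u: "u = qpoint x y I"
  defines "v1 \<equiv> qpoint (fst v) (v \<bullet> I) I"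
  shows "h_norm_sq u v =
    1 / (4 * (fst u)\<^sup>2) * (norm v1)\<^sup>2 + 1 / (4 * (norm u)\<^sup>2) * (norm (v - v1))\<^sup>2"
    (is "_ = ?r")
proof -
  have v1s: "v1 \<in> slice I"
    by (auto simp: slice_def v1_def)
  have II: "I \<bullet> I = 1" "fst I = 0"
    using I by (simp_all add: imag_units_iff inner_prod_def norm_eq_1)
  have v2s: "v - v1 \<in> orthogonal_comp (slice I)"
  proof -
    have "qpoint a b I \<bullet> (v - v1) = 0" for a b
    proof -
      have "snd I \<bullet> snd I = 1" "v \<bullet> I = snd I \<bullet> snd v"
        using II by (simp_all add: inner_prod_def inner_commute)
      then show ?thesis
        using II by (simp add: v1_def qpoint_def qone_def inner_prod_def inner_diff_right)
    qed
    then show ?thesis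
      by (auto simp: orthogonal_comp_def orthogonal_def slice_def)
  qed
  have pyth: "(norm v)\<^sup>2 = (norm a)\<^sup>2 + (norm b)\<^sup>2"
    if "a \<in> slice J" "b \<in> orthogonal_comp (slice J)" "v = a + b" for a b J
    using norm_add_Pythagorean[of a b] that by (auto simp: orthogonal_comp_def)
  show ?thesis
    unfolding h_norm_sq_def
  proof (rule the_equality)
    show "\<exists>x y I v1 v2. I \<in> imag_units \<and> y \<ge> 0 \<and> u = qpoint x y I \<and> v1 \<in> slice I \<and>
        v2 \<in> orthogonal_comp (slice I) \<and> v = v1 + v2 \<and>
        ?r = 1 / (4 * (fst u)\<^sup>2) * (norm v1)\<^sup>2 + 1 / (4 * (norm u)\<^sup>2) * (norm v2)\<^sup>2"
      by (intro exI[of _ x] exI[of _ y] exI[of _ I] exI[of _ v1] exI[of _ "v - v1"])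
        (simp add: I y u v1s v2s)
  next
    fix r
    assume "\<exists>x y I v1 v2. I \<in> imag_units \<and> y \<ge> 0 \<and> u = qpoint x y I \<and> v1 \<in> slice I \<and>
        v2 \<in> orthogonal_comp (slice I) \<and> v = v1 + v2 \<and>
        r = 1 / (4 * (fst u)\<^sup>2) * (norm v1)\<^sup>2 + 1 / (4 * (norm u)\<^sup>2) * (norm v2)\<^sup>2"
    then obtain x' y' J w1 w2 where J: "J \<in> imag_units" "y' \<ge> 0" "u = qpoint x' y' J"
      and w: "w1 \<in> slice J" "w2 \<in> orthogonal_comp (slice J)" "v = w1 + w2"
      and r: "r = 1 / (4 * (fst u)\<^sup>2) * (norm w1)\<^sup>2 + 1 / (4 * (norm u)\<^sup>2) * (norm w2)\<^sup>2"
      by blast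
    have coords: "fst (qpoint a b K) = a \<and> snd (qpoint a b K) = b *\<^sub>R snd K"
      if "K \<in> imag_units" for a b K
      using that by (simp add: qpoint_def qone_def imag_units_iff)
    have *: "fst u = x'" "fst u = x" "snd u = y' *\<^sub>R snd J" "snd u = y *\<^sub>R snd I"
      using coords[OF J(1), of x' y'] coords[OF I, of x y] J(3) u by simp_all
    then have "norm (snd u) = y'" "norm (snd u) = y"
      using I J(1,2) y by (metis imag_units_iff norm_scaleR abs_of_nonneg mult.right_neutral)+
    then have yy: "y' = y" by simp
    show "r = ?r"
    proof (cases "y = 0")
      case True
      then have "norm u = \<bar>fst u\<bar>"
        using * by (simp add: norm_prod_def)
      then have nu: "(norm u)\<^sup>2 = (fst u)\<^sup>2" by simp
      have "r = 1 / (4 * (fst u)\<^sup>2) * (norm v)\<^sup>2"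
        unfolding r nu pyth[OF w] by (simp add: add_divide_distrib)
      moreover have "(norm v)\<^sup>2 = (norm v1)\<^sup>2 + (norm (v - v1))\<^sup>2"
        using pyth[OF v1s v2s] by simp
      ultimately show ?thesis
        unfolding nu by (simp only: distrib_left)
    next
      case False
      then have "snd I = snd J" using * yy by simp
      then have "I = J" using I J(1) by (simp add: imag_units_iff prod_eq_iff)
      then have "w1 = v1" using slice_decomp[OF J(1) w] by (simp add: v1_def)
      then show ?thesis using r w by simp
    qed
  qed
qed

end

theory Submission
  imports Defs
begin

text \<open>The constants are \<open>C1 = 1 / (1 + \<pi>)\<close> and \<open>C2 = 1\<close>.

  \<^emph>\<open>Upper bound.\<close> Every slice contains an isometric copy of the hyperbolic half plane
  (\<open>d_h_slice_le_d_hyp\<close>), and turning the imaginary unit of \<open>x + y I\<close> through an angle \<open>\<theta>\<close> costs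
  \<open>y \<theta> / (2 |q|)\<close>, since that motion is orthogonal to the slices (\<open>d_h_rotation_le\<close>). A path from
  \<open>q1\<close> to \<open>q2\<close> may turn first and then move inside the slice of \<open>I2\<close>, or move inside the slice of
  \<open>I1\<close> and then turn; the cheaper choice gives the minimum in \<open>E\<close>.

  \<^emph>\<open>Lower bound.\<close> Each of the two terms of \<open>E\<close> is estimated by a Lipschitz map, so
  that no curve has to be cut into pieces. The first map is the projection \<open>\<pi>\<close> to the half
  plane, which contracts \<open>h\<close>. For \<open>q = x + s\<close> with imaginary part \<open>s\<close> it has the ordinate
  \<open>|s|\<close> and fails to be differentiable on the real axis, so \<open>|s|\<close> is replaced by
  \<open>sqrt (|s|\<^sup>2 + \<epsilon>\<^sup>2)\<close>, which still contracts, and then \<open>\<epsilon>\<close> tends to \<open>0\<close>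
  (\<open>d_hyp_proj_le_d_h\<close>). The second map is \<open>q \<mapsto> q / |q|\<close> into Euclidean space. It is
  \<open>2\<close>-Lipschitz because \<open>h\<close> dominates \<open>|v|\<^sup>2 / (4 |u|\<^sup>2)\<close>, and the imaginary part of
  \<open>q / |q|\<close> is \<open>(y / |q|) I\<close>: its displacement is at least \<open>min (y1 / |q1|) (y2 / |q2|)\<close> times the
  chord from \<open>I1\<close> to \<open>I2\<close>, which is at least \<open>2 / \<pi>\<close> times the spherical distance
  (\<open>spherical_term_le_d_h\<close>).\<close>

section \<open>Infima of curve lengths\<close>

definition curve_lengths :: "quat set \<Rightarrow> (quat \<Rightarrow> quat \<Rightarrow> real) \<Rightarrow> quat \<Rightarrow> quat \<Rightarrow> real set"
  where "curve_lengths M N p q = {l. \<exists>\<gamma>. \<gamma> piecewise_C1_differentiable_on {0..1} \<and>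
    path_image \<gamma> \<subseteq> M \<and> pathstart \<gamma> = p \<and> pathfinish \<gamma> = q \<and>
    ((\<lambda>t. N (\<gamma> t) (vector_derivative \<gamma> (at t))) has_integral l) {0..1}}"

lemma riem_dist_eq_Inf: "riem_dist M N p q = Inf (curve_lengths M N p q)"
  by (simp add: riem_dist_def curve_lengths_def)

text \<open>The properties of the length of a tangent vector on which the triangle inequality and the
  comparison of distances rest. Homogeneity in \<open>v\<close> accounts for a change of
  the speed of a curve.\<close>

definition length_density :: "quat set \<Rightarrow> (quat \<Rightarrow> quat \<Rightarrow> real) \<Rightarrow> bool"
  where "length_density M N \<longleftrightarrow> continuous_on (M \<times> UNIV) (\<lambda>(u, v). N u v) \<and>
    (\<forall>u\<in>M. \<forall>v. 0 \<le> N u v \<and> (\<forall>c\<ge>0. N u (c *\<^sub>R v) = c * N u v))"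

lemma length_density_nonneg: "length_density M N \<Longrightarrow> u \<in> M \<Longrightarrow> 0 \<le> N u v"
  and length_density_scaleR:
    "length_density M N \<Longrightarrow> u \<in> M \<Longrightarrow> 0 \<le> c \<Longrightarrow> N u (c *\<^sub>R v) = c * N u v"
  unfolding length_density_def by blast+

lemma continuous_on_curried:
  assumes "continuous_on (M \<times> UNIV) (\<lambda>(u, v). F u v)" "continuous_on T f" "continuous_on T g"
    "\<And>t. t \<in> T \<Longrightarrow> f t \<in> M"
  shows "continuous_on T (\<lambda>t. F (f t) (g t))"
proof -
  have "continuous_on T (\<lambda>t. (\<lambda>(u, v). F u v) (f t, g t))"
    by (rule continuous_on_compose2[OF assms(1)]) (use assms in \<open>auto intro: continuous_on_Pair\<close>)
  then show ?thesis by simp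
qed

text \<open>The derivative of a curve may be any \<open>D\<close> that is correct off the finite set of break points,
  because the values of the speed on that set do not affect the length.\<close>

lemma curve_lengthsE:
  assumes "l \<in> curve_lengths M N p q"
  obtains \<gamma> D S where "finite S" "continuous_on {0..1} \<gamma>"
    "\<And>t. t \<in> {0..1} - S \<Longrightarrow> (\<gamma> has_vector_derivative D t) (at t)" "continuous_on ({0..1} - S) D"
    "\<And>t. t \<in> {0..1} \<Longrightarrow> \<gamma> t \<in> M" "\<gamma> 0 = p" "\<gamma> 1 = q"
    "((\<lambda>t. N (\<gamma> t) (D t)) has_integral l) {0..1}"
proof -
  obtain \<gamma> where g: "\<gamma> piecewise_C1_differentiable_on {0..1}" "path_image \<gamma> \<subseteq> M"
    "pathstart \<gamma> = p" "pathfinish \<gamma> = q"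
    and len: "((\<lambda>t. N (\<gamma> t) (vector_derivative \<gamma> (at t))) has_integral l) {0..1}"
    using assms by (auto simp: curve_lengths_def)
  obtain S D where S: "finite S" "continuous_on {0..1} \<gamma>"
    "\<And>t. t \<in> {0..1} - S \<Longrightarrow> (\<gamma> has_vector_derivative D t) (at t)" "continuous_on ({0..1} - S) D"
    using g(1) unfolding piecewise_C1_differentiable_on_def C1_differentiable_on_def by blast
  have "((\<lambda>t. N (\<gamma> t) (D t)) has_integral l) {0..1}"
    by (rule has_integral_spike_finite[OF S(1) _ len]) (metis S(3) vector_derivative_at)
  moreover have "\<And>t. t \<in> {0..1} \<Longrightarrow> \<gamma> t \<in> M"
    using g(2) by (auto simp: path_image_def)
  ultimately show thesis
    using that[OF S] g(3,4) by (simp add: pathstart_def pathfinish_def)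
qed

lemma curve_lengthsI:
  assumes S: "finite S" "continuous_on {0..1} \<gamma>"
    "\<And>t. t \<in> {0..1} - S \<Longrightarrow> (\<gamma> has_vector_derivative D t) (at t)" "continuous_on ({0..1} - S) D"
    and M: "\<And>t. t \<in> {0..1} \<Longrightarrow> \<gamma> t \<in> M"
    and len: "((\<lambda>t. N (\<gamma> t) (D t)) has_integral l) {0..1}"
  shows "l \<in> curve_lengths M N (\<gamma> 0) (\<gamma> 1)"
proof -
  have "\<gamma> piecewise_C1_differentiable_on {0..1}"
    unfolding piecewise_C1_differentiable_on_def C1_differentiable_on_def using S by blast
  moreover have "((\<lambda>t. N (\<gamma> t) (vector_derivative \<gamma> (at t))) has_integral l) {0..1}"
    by (rule has_integral_spike_finite[OF S(1) _ len]) (metis S(3) vector_derivative_at)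
  ultimately show ?thesis
    using M unfolding curve_lengths_def pathstart_def pathfinish_def path_image_def by blast
qed

lemma curve_lengths_nonneg:
  assumes "length_density M N" "l \<in> curve_lengths M N p q"
  shows "0 \<le> l"
  using assms(2)
proof (rule curve_lengthsE)
  fix \<gamma> :: "real \<Rightarrow> quat" and D :: "real \<Rightarrow> quat"
  assume "\<And>t. t \<in> {0..1} \<Longrightarrow> \<gamma> t \<in> M" "((\<lambda>t. N (\<gamma> t) (D t)) has_integral l) {0..1}"
  then show ?thesis
    using length_density_nonneg[OF assms(1)] by (blast intro: has_integral_nonneg)
qed

lemma riem_dist_le:
  assumes "length_density M N" "l \<in> curve_lengths M N p q"
  shows "riem_dist M N p q \<le> l"
  unfolding riem_dist_eq_Inf
  by (rule cInf_lower[OF assms(2)]) (meson assms(1) bdd_belowI curve_lengths_nonneg)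

lemma riem_dist_greatest:
  assumes "curve_lengths M N p q \<noteq> {}" "\<And>l. l \<in> curve_lengths M N p q \<Longrightarrow> c \<le> l"
  shows "c \<le> riem_dist M N p q"
  unfolding riem_dist_eq_Inf by (rule cInf_greatest[OF assms])

lemma C1_curve_length:
  assumes N: "length_density M N"
    and D: "\<And>t. t \<in> {0..1} \<Longrightarrow> (\<gamma> has_vector_derivative D t) (at t)" "continuous_on {0..1} D"
    and M: "\<And>t. t \<in> {0..1} \<Longrightarrow> \<gamma> t \<in> M"
  shows "integral {0..1} (\<lambda>t. N (\<gamma> t) (D t)) \<in> curve_lengths M N (\<gamma> 0) (\<gamma> 1)"
proof (rule curve_lengthsI[where S = "{}" and D = D])
  show c: "continuous_on {0..1} \<gamma>"
    using D(1) by (meson continuous_at_imp_continuous_on has_vector_derivative_continuous)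
  have "continuous_on {0..1} (\<lambda>t. N (\<gamma> t) (D t))"
    by (rule continuous_on_curried[OF _ c D(2) M]) (use N in \<open>auto simp: length_density_def\<close>)
  then show "((\<lambda>t. N (\<gamma> t) (D t)) has_integral integral {0..1} (\<lambda>t. N (\<gamma> t) (D t))) {0..1}"
    by (simp add: integrable_continuous_real integrable_integral)
qed (use D M in auto)

lemma constant_speed_length:
  assumes N: "length_density M N"
    and D: "\<And>t. t \<in> {0..1} \<Longrightarrow> (\<gamma> has_vector_derivative D t) (at t)" "continuous_on {0..1} D"
    and M: "\<And>t. t \<in> {0..1} \<Longrightarrow> \<gamma> t \<in> M"
    and s: "\<And>t. t \<in> {0..1} \<Longrightarrow> N (\<gamma> t) (D t) = s"
  shows "s \<in> curve_lengths M N (\<gamma> 0) (\<gamma> 1)"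
proof -
  have "integral {0..1} (\<lambda>t. N (\<gamma> t) (D t)) = integral {0..1} (\<lambda>t::real. s)"
    using s by (intro integral_cong) auto
  then show ?thesis
    using C1_curve_length[OF N D M] by simp
qed

lemma curve_lengths_nonempty:
  assumes "length_density M N" "convex M" "p \<in> M" "q \<in> M"
  shows "curve_lengths M N p q \<noteq> {}"
proof -
  have "integral {0..1} (\<lambda>t. N (p + t *\<^sub>R (q - p)) (q - p)) \<in>
    curve_lengths M N (p + 0 *\<^sub>R (q - p)) (p + 1 *\<^sub>R (q - p))"
  proof (rule C1_curve_length[OF assms(1)])
    show "((\<lambda>t. p + t *\<^sub>R (q - p)) has_vector_derivative q - p) (at t)" for t
      by (auto intro!: derivative_eq_intros)
    show "p + t *\<^sub>R (q - p) \<in> M" if "t \<in> {0..1}" for t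
      using convexD_alt[OF assms(2-4), of t] that by (simp add: algebra_simps)
  qed auto
  then show ?thesis by auto
qed

text \<open>\<open>F\<close> sends an admissible curve to an admissible curve that is not longer. The image curve
  has a length because its speed is continuous off finitely many points and bounded by the
  integrable speed of the given curve. Continuity of the derivative \<open>F'\<close> makes the image
  piecewise \<open>C\<^sup>1\<close>.\<close>

lemma riem_dist_contraction:
  assumes N': "length_density M' N'"
    and ne: "curve_lengths M N p q \<noteq> {}"
    and F: "\<And>u. u \<in> M \<Longrightarrow> (F has_derivative F' u) (at u)"
    and cF': "continuous_on (M \<times> UNIV) (\<lambda>(u, v). F' u v)"
    and sub: "\<And>u. u \<in> M \<Longrightarrow> F u \<in> M'"
    and le: "\<And>u v. u \<in> M \<Longrightarrow> N' (F u) (F' u v) \<le> N u v"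
  shows "riem_dist M' N' (F p) (F q) \<le> riem_dist M N p q"
proof (rule riem_dist_greatest[OF ne])
  fix l assume "l \<in> curve_lengths M N p q"
  then show "riem_dist M' N' (F p) (F q) \<le> l"
  proof (rule curve_lengthsE)
    fix \<gamma> D S
    assume S: "finite S" and c\<gamma>: "continuous_on {0..1} \<gamma>"
      and D: "\<And>t. t \<in> {0..1} - S \<Longrightarrow> (\<gamma> has_vector_derivative D t) (at t)"
      and cD: "continuous_on ({0..1} - S) D"
      and M: "\<And>t. t \<in> {0..1} \<Longrightarrow> \<gamma> t \<in> M" and pq: "\<gamma> 0 = p" "\<gamma> 1 = q"
      and len: "((\<lambda>t. N (\<gamma> t) (D t)) has_integral l) {0..1}"
    let ?D = "\<lambda>t. F' (\<gamma> t) (D t)" and ?T = "{0..1} - S"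
    have cG: "continuous_on {0..1} (\<lambda>t. F (\<gamma> t))"
      using F M
      by (intro continuous_on_compose2[OF _ c\<gamma>, where t = "\<gamma> ` {0..1}"]
          continuous_at_imp_continuous_on ballI) (blast intro: has_derivative_continuous)+
    have G: "((\<lambda>t. F (\<gamma> t)) has_vector_derivative ?D t) (at t)" if "t \<in> ?T" for t
    proof -
      interpret bounded_linear "F' (\<gamma> t)"
        using F M that by (meson DiffD1 has_derivative_bounded_linear)
      have "(F \<circ> \<gamma> has_derivative F' (\<gamma> t) \<circ> (\<lambda>h. h *\<^sub>R D t)) (at t)"
        using D[OF that] F M that by (intro diff_chain_at) (auto simp: has_vector_derivative_def)
      then show ?thesis
        by (simp add: has_vector_derivative_def o_def scaleR)
    qed
    have c\<gamma>T: "continuous_on ?T \<gamma>"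
      using c\<gamma> by (rule continuous_on_subset) auto
    have cG': "continuous_on ?T ?D"
      using M by (intro continuous_on_curried[OF cF' c\<gamma>T cD]) auto
    have cN: "continuous_on ?T (\<lambda>t. N' (F (\<gamma> t)) (?D t))"
      using N' continuous_on_subset[OF cG, of ?T] cG' sub M
      by (intro continuous_on_curried[of M' N']) (auto simp: length_density_def)
    have spike: "(f has_integral i) ?T \<longleftrightarrow> (f has_integral i) {0..1}" for f :: "real \<Rightarrow> real" and i
      by (rule has_integral_spike_set_eq; rule negligible_subset[OF negligible_finite[OF S]]) auto
    have lenT: "((\<lambda>t. N (\<gamma> t) (D t)) has_integral l) ?T"
      using len spike by blast
    have T: "?T \<in> sets lebesgue"
      using sets.Diff[OF _ negligible_imp_sets[OF negligible_finite[OF S]], of "{0..1}"] by simp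
    have "(\<lambda>t. N' (F (\<gamma> t)) (?D t)) integrable_on ?T"
    proof (rule measurable_bounded_by_integrable_imp_integrable[OF _ _ _ T])
      show "(\<lambda>t. N' (F (\<gamma> t)) (?D t)) \<in> borel_measurable (lebesgue_on ?T)"
        by (rule continuous_imp_measurable_on_sets_lebesgue[OF cN T])
      show "(\<lambda>t. N (\<gamma> t) (D t)) integrable_on ?T"
        using lenT by blast
      show "norm (N' (F (\<gamma> t)) (?D t)) \<le> N (\<gamma> t) (D t)" if "t \<in> ?T" for t
        using that M le sub length_density_nonneg[OF N'] by simp
    qed
    then obtain l' where l': "((\<lambda>t. N' (F (\<gamma> t)) (?D t)) has_integral l') ?T"
      by blast
    have "l' \<in> curve_lengths M' N' (F (\<gamma> 0)) (F (\<gamma> 1))"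
      by (rule curve_lengthsI[OF S cG G cG']) (use sub M l' spike in auto)
    then have "riem_dist M' N' (F p) (F q) \<le> l'"
      using riem_dist_le[OF N'] pq by simp
    also have "l' \<le> l"
      by (rule has_integral_le[OF l' lenT]) (use M le in auto)
    finally show ?thesis .
  qed
qed

text \<open>In a multiple of the Euclidean metric no curve is shorter than the chord, by the fundamental
  theorem of calculus.\<close>

lemma displacement_le_length:
  assumes "l \<in> curve_lengths M (\<lambda>u v. c * norm v) p q" "0 \<le> c"
  shows "c * norm (q - p) \<le> l"
  using assms(1)
proof (rule curve_lengthsE)
  fix \<gamma> D S
  assume S: "finite S" "continuous_on {0..1} \<gamma>"
    "\<And>t. t \<in> {0..1} - S \<Longrightarrow> (\<gamma> has_vector_derivative D t) (at t)"
    and pq: "\<gamma> 0 = p" "\<gamma> 1 = q"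
    and len: "((\<lambda>t. c * norm (D t)) has_integral l) {0..1}"
  have "(D has_integral q - p) {0..1}"
    using fundamental_theorem_of_calculus_strong[OF S(1) _ S(3,2)] pq by simp
  then have "((\<lambda>t. c *\<^sub>R D t) has_integral c *\<^sub>R (q - p)) {0..1}"
    by (rule has_integral_cmul)
  moreover from this have "norm (integral {0..1} (\<lambda>t. c *\<^sub>R D t)) \<le> integral {0..1} (\<lambda>t. c * norm (D t))"
    using len assms(2) by (intro integral_norm_bound_integral) (auto simp: has_integral_integrable)
  ultimately have "norm (c *\<^sub>R (q - p)) \<le> l"
    using len by (metis integral_unique)
  then show ?thesis
    using assms(2) by simp
qed

text \<open>Lengths add up under concatenation: each half of the joined path runs at twice the speed, and
  homogeneity of \<open>N\<close> moves the factor \<open>2\<close> out, where it cancels against the halved parameter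
  interval.\<close>

lemma curve_lengths_concat:
  assumes N: "length_density M N"
    and l1: "l1 \<in> curve_lengths M N p q" and l2: "l2 \<in> curve_lengths M N q r"
  shows "l1 + l2 \<in> curve_lengths M N p r"
proof -
  obtain g1 where g1: "valid_path g1" "path_image g1 \<subseteq> M" "pathstart g1 = p" "pathfinish g1 = q"
    and 1: "((\<lambda>t. N (g1 t) (vector_derivative g1 (at t))) has_integral l1) {0..1}"
    using l1 by (auto simp: curve_lengths_def valid_path_def)
  obtain g2 where g2: "valid_path g2" "path_image g2 \<subseteq> M" "pathstart g2 = q" "pathfinish g2 = r"
    and 2: "((\<lambda>t. N (g2 t) (vector_derivative g2 (at t))) has_integral l2) {0..1}"
    using l2 by (auto simp: curve_lengths_def valid_path_def)
  \<comment> \<open>The derivative of the joined path can be off at the images of \<open>s1\<close>, \<open>s2\<close> and at the joint \<open>1/2\<close>.\<close>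
  obtain s1 s2
    where s1: "finite s1" "\<forall>x\<in>{0..1} - s1. g1 differentiable at x"
      and s2: "finite s2" "\<forall>x\<in>{0..1} - s2. g2 differentiable at x"
    using g1(1) g2(1)
    by (auto simp: valid_path_def piecewise_C1_differentiable_on_def C1_differentiable_on_eq)
  have i1: "((\<lambda>x. 2 * N (g1 (2*x)) (vector_derivative g1 (at (2*x)))) has_integral l1) {0..1/2}"
    and i2: "((\<lambda>x. 2 * N (g2 (2*x - 1)) (vector_derivative g2 (at (2*x - 1)))) has_integral l2) {1/2..1}"
    using has_integral_affinity01[OF 1, where m = 2 and c = 0, THEN has_integral_cmul[where c = 2]]
          has_integral_affinity01[OF 2, where m = 2 and c = "-1", THEN has_integral_cmul[where c = 2]]
    by (simp_all only: image_affinity_atLeastAtMost_div_diff, simp_all add: mult_ac)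
  have d1: "vector_derivative (g1 +++ g2) (at z) = 2 *\<^sub>R vector_derivative g1 (at (2*z))"
    if "0 \<le> z" "2*z < 1" "2*z \<notin> s1" for z
  proof (rule vector_derivative_at[OF has_vector_derivative_transform_within])
    show "0 < \<bar>z - 1/2\<bar>" using that by auto
    have "((*) 2 has_vector_derivative 2) (at z)"
      by (auto intro!: derivative_eq_intros)
    moreover have "(g1 has_vector_derivative vector_derivative g1 (at (2*z))) (at (2*z))"
      using s1 that by (auto simp: vector_derivative_works)
    ultimately show "((\<lambda>x. g1 (2*x)) has_vector_derivative 2 *\<^sub>R vector_derivative g1 (at (2*z))) (at z)"
      by (intro vector_diff_chain_at[simplified o_def])
  qed (use that in \<open>auto simp: joinpaths_def dist_real_def abs_if split: if_split_asm\<close>)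
  have d2: "vector_derivative (g1 +++ g2) (at z) = 2 *\<^sub>R vector_derivative g2 (at (2*z - 1))"
    if "1 < 2*z" "z \<le> 1" "2*z - 1 \<notin> s2" for z
  proof (rule vector_derivative_at[OF has_vector_derivative_transform_within])
    show "0 < \<bar>z - 1/2\<bar>" using that by auto
    have "((\<lambda>x. 2*x - 1) has_vector_derivative 2) (at z)"
      by (auto intro!: derivative_eq_intros)
    moreover have "(g2 has_vector_derivative vector_derivative g2 (at (2*z - 1))) (at (2*z - 1))"
      using s2 that by (auto simp: vector_derivative_works)
    ultimately show "((\<lambda>x. g2 (2*x - 1)) has_vector_derivative 2 *\<^sub>R vector_derivative g2 (at (2*z - 1))) (at z)"
      by (intro vector_diff_chain_at[simplified o_def])
  qed (use that in \<open>auto simp: joinpaths_def dist_real_def abs_if split: if_split_asm\<close>)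
  have hom: "N (g1 x) (2 *\<^sub>R v) = 2 * N (g1 x) v" "N (g2 x) (2 *\<^sub>R v) = 2 * N (g2 x) v"
    if "x \<in> {0..1}" for x v
    using g1(2) g2(2) that by (auto simp: path_image_def intro!: length_density_scaleR[OF N])
  have j1: "(g1 +++ g2) x = g1 (2*x)" if "x < 1/2" for x
    using that by (simp add: joinpaths_def)
  have j2: "(g1 +++ g2) x = g2 (2*x - 1)" if "1/2 < x" for x
    using that by (simp add: joinpaths_def)
  let ?f = "\<lambda>x. N ((g1 +++ g2) x) (vector_derivative (g1 +++ g2) (at x))"
  have "(?f has_integral l1) {0..1/2}"
  proof (rule has_integral_spike_finite[OF _ _ i1])
    show "finite (insert (1/2) ((*) 2 -` s1))"
      using s1 by (force intro: finite_vimageI[where h = "(*) 2"] inj_onI)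
    show "?f x = 2 * N (g1 (2*x)) (vector_derivative g1 (at (2*x)))"
      if "x \<in> {0..1/2} - insert (1/2) ((*) 2 -` s1)" for x
      using that by (simp add: j1 d1 hom)
  qed
  moreover have "(?f has_integral l2) {1/2..1}"
  proof (rule has_integral_spike_finite[OF _ _ i2])
    show "finite (insert (1/2) ((\<lambda>x. 2*x - 1) -` s2))"
      using s2 by (force intro: finite_vimageI[where h = "\<lambda>x. 2*x - 1"] inj_onI)
    show "?f x = 2 * N (g2 (2*x - 1)) (vector_derivative g2 (at (2*x - 1)))"
      if "x \<in> {1/2..1} - insert (1/2) ((\<lambda>x. 2*x - 1) -` s2)" for x
      using that by (simp add: j2 d2 hom)
  qed
  ultimately have "(?f has_integral l1 + l2) {0..1}"
    by (intro has_integral_combine[where c = "1/2"]) auto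
  moreover have "valid_path (g1 +++ g2)"
    using g1 g2 by (intro valid_path_join) auto
  moreover have "path_image (g1 +++ g2) \<subseteq> M"
    using g1(2) g2(2) by (rule subset_path_image_join)
  ultimately show ?thesis
    unfolding curve_lengths_def valid_path_def using g1(3) g2(4)
    by (auto intro!: exI[of _ "g1 +++ g2"])
qed

lemma riem_dist_triangle:
  assumes N: "length_density M N" and ne: "curve_lengths M N p q \<noteq> {}" "curve_lengths M N q r \<noteq> {}"
  shows "riem_dist M N p r \<le> riem_dist M N p q + riem_dist M N q r"
proof -
  have "riem_dist M N p r - l2 \<le> riem_dist M N p q" if l2: "l2 \<in> curve_lengths M N q r" for l2
  proof (rule riem_dist_greatest[OF ne(1)])
    fix l1 assume "l1 \<in> curve_lengths M N p q"
    then show "riem_dist M N p r - l2 \<le> l1"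
      using riem_dist_le[OF N curve_lengths_concat[OF N _ l2]] by (simp add: diff_le_eq)
  qed
  then have "riem_dist M N p r - riem_dist M N p q \<le> riem_dist M N q r"
    by (intro riem_dist_greatest[OF ne(2)]) (simp add: diff_le_eq add.commute)
  then show ?thesis by simp
qed

section \<open>The two metrics\<close>

lemma qpoint_imag_unit:
  assumes "I \<in> imag_units"
  shows "fst (qpoint x y I) = x" "snd (qpoint x y I) = y *\<^sub>R snd I" "qpoint x y I \<bullet> I = y"
    "norm (qpoint x y I) = sqrt (x\<^sup>2 + y\<^sup>2)"
  using assms by (simp_all add: qpoint_def qone_def imag_units_iff inner_prod_def norm_prod_def dot_square_norm)

lemma qpoint_exists:
  obtains I where "I \<in> imag_units" "u = qpoint (fst u) (norm (snd u)) I"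
proof (cases "snd u = 0")
  case True
  then show thesis
    by (intro that[of "(0, axis 1 1)"]) (auto simp: imag_units_iff norm_axis_1 qpoint_def qone_def prod_eq_iff)
next
  case False
  then show thesis
    by (intro that[of "(0, sgn (snd u))"]) (auto simp: imag_units_iff norm_sgn qpoint_def qone_def prod_eq_iff sgn_div_norm)
qed

text \<open>A formula for \<open>h\<close> without the choice of an imaginary unit: as \<open>snd u = y I\<close>, the terms
  \<open>y\<^sup>2\<close> and \<open>y (v \<bullet> I)\<close> are polynomial in the coordinates. It shows that \<open>h\<close> is continuous across
  the real axis and that it dominates \<open>|v|\<^sup>2 / (4 |u|\<^sup>2)\<close>.\<close>

lemma h_norm_sq_formula:
  assumes "0 < fst u"
  shows "h_norm_sq u v =
    ((norm v)\<^sup>2 + ((fst v)\<^sup>2 * (norm (snd u))\<^sup>2 + (snd v \<bullet> snd u)\<^sup>2) / (fst u)\<^sup>2) / (4 * (norm u)\<^sup>2)"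
proof -
  define x y where xy: "x = fst u" "y = norm (snd u)"
  obtain I where I: "I \<in> imag_units" and u: "u = qpoint x y I"
    using qpoint_exists[of u] xy by metis
  define a b where ab: "a = fst v" "b = v \<bullet> I"
  have x: "x > 0" using assms xy by simp
  have nu: "(norm u)\<^sup>2 = x\<^sup>2 + y\<^sup>2"
    using I by (simp add: u qpoint_imag_unit)
  have s: "snd v \<bullet> snd u = y * b"
    using I unfolding u ab by (simp add: qpoint_imag_unit inner_prod_def imag_units_iff)
  have n1: "(norm (qpoint a b I))\<^sup>2 = a\<^sup>2 + b\<^sup>2"
    using I by (simp add: qpoint_imag_unit)
  have vq: "v \<bullet> qpoint a b I = a\<^sup>2 + b\<^sup>2"
    unfolding qpoint_def qone_def inner_right_distrib inner_scaleR_right ab(2)[symmetric]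
    by (simp add: inner_prod_def ab(1) power2_eq_square)
  have n2: "(norm (v - qpoint a b I))\<^sup>2 = (norm v)\<^sup>2 - (a\<^sup>2 + b\<^sup>2)"
    using n1 vq unfolding power2_norm_eq_inner by (simp add: inner_diff inner_commute)
  have "h_norm_sq u v = 1 / (4 * x\<^sup>2) * (a\<^sup>2 + b\<^sup>2) + 1 / (4 * (x\<^sup>2 + y\<^sup>2)) * ((norm v)\<^sup>2 - (a\<^sup>2 + b\<^sup>2))"
    using h_norm_sq_eq[OF I _ u, of v] unfolding ab[symmetric] n1 n2 nu xy(1)[symmetric]
    by (simp add: xy)
  also have "\<dots> = ((norm v)\<^sup>2 + (a\<^sup>2 * y\<^sup>2 + (y * b)\<^sup>2) / x\<^sup>2) / (4 * (x\<^sup>2 + y\<^sup>2))"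
  proof -
    have "1 / (4 * P) * A + 1 / (4 * Q) * (V - A) = (V + A * (Q - P) / P) / (4 * Q)"
      if "P > 0" "Q > 0" for P Q A V :: real
      using that by (simp add: field_simps)
    from this[of "x\<^sup>2" "x\<^sup>2 + y\<^sup>2"] show ?thesis
      using x by (simp add: add_pos_nonneg power_mult_distrib algebra_simps)
  qed
  finally show ?thesis
    by (simp add: nu s ab flip: xy)
qed

lemma h_norm_sq_nonneg: "0 < fst u \<Longrightarrow> 0 \<le> h_norm_sq u v"
  by (simp add: h_norm_sq_formula)

lemma length_density_h: "length_density quat_half_space (\<lambda>u v. sqrt (h_norm_sq u v))"
proof -
  have "continuous_on (quat_half_space \<times> UNIV) (\<lambda>(u, v). sqrt (
      ((norm v)\<^sup>2 + ((fst v)\<^sup>2 * (norm (snd u))\<^sup>2 + (snd v \<bullet> snd u)\<^sup>2) / (fst u)\<^sup>2) / (4 * (norm u)\<^sup>2)))"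
    unfolding case_prod_beta
    by (intro continuous_intros) (auto simp: quat_half_space_def zero_prod_def)
  moreover have "(\<lambda>(u, v). sqrt (
      ((norm v)\<^sup>2 + ((fst v)\<^sup>2 * (norm (snd u))\<^sup>2 + (snd v \<bullet> snd u)\<^sup>2) / (fst u)\<^sup>2) / (4 * (norm u)\<^sup>2))) z
      = (\<lambda>(u, v). sqrt (h_norm_sq u v)) z" if "z \<in> quat_half_space \<times> UNIV" for z
    using that by (cases z) (simp add: quat_half_space_def h_norm_sq_formula)
  ultimately have "continuous_on (quat_half_space \<times> UNIV) (\<lambda>(u, v). sqrt (h_norm_sq u v))"
    by (rule continuous_on_eq)
  moreover have "sqrt (h_norm_sq u (c *\<^sub>R v)) = c * sqrt (h_norm_sq u v)" if "0 < fst u" "0 \<le> c" for u v c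
  proof -
    have "h_norm_sq u (c *\<^sub>R v) = c\<^sup>2 * h_norm_sq u v"
      using that by (simp add: h_norm_sq_formula power_mult_distrib field_simps)
    then show ?thesis
      using that by (simp add: real_sqrt_mult)
  qed
  ultimately show ?thesis
    unfolding length_density_def using h_norm_sq_nonneg by (simp add: quat_half_space_def)
qed

lemma length_density_hyp:
  assumes "I \<in> imag_units"
  shows "length_density (slice_half_plane I)
    (\<lambda>u v. sqrt (((fst v)\<^sup>2 + (v \<bullet> I)\<^sup>2) / (4 * (fst u)\<^sup>2)))"
proof -
  have pos: "fst u > 0" if "u \<in> slice_half_plane I" for u
    using that assms by (auto simp: slice_half_plane_def qpoint_imag_unit)
  have "sqrt (((fst (c *\<^sub>R v))\<^sup>2 + ((c *\<^sub>R v) \<bullet> I)\<^sup>2) / (4 * (fst u)\<^sup>2)) =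
      c * sqrt (((fst v)\<^sup>2 + (v \<bullet> I)\<^sup>2) / (4 * (fst u)\<^sup>2))" if "0 \<le> c" for u v :: quat and c
  proof -
    have "((fst (c *\<^sub>R v))\<^sup>2 + ((c *\<^sub>R v) \<bullet> I)\<^sup>2) / (4 * (fst u)\<^sup>2) =
      c\<^sup>2 * (((fst v)\<^sup>2 + (v \<bullet> I)\<^sup>2) / (4 * (fst u)\<^sup>2))"
      by (simp add: power_mult_distrib field_simps)
    then show ?thesis
      using that by (simp only: real_sqrt_mult real_sqrt_abs abs_of_nonneg)
  qed
  moreover have "continuous_on (slice_half_plane I \<times> UNIV)
      (\<lambda>(u, v). sqrt (((fst v)\<^sup>2 + (v \<bullet> I)\<^sup>2) / (4 * (fst u)\<^sup>2)))"
    unfolding case_prod_beta by (intro continuous_intros) (auto dest!: pos)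
  ultimately show ?thesis
    unfolding length_density_def by simp
qed

lemma convex_quat_half_space: "convex quat_half_space"
proof (rule convexI)
  fix p q :: quat and s t :: real
  assume "p \<in> quat_half_space" "q \<in> quat_half_space" "0 \<le> s" "0 \<le> t" "s + t = 1"
  then show "s *\<^sub>R p + t *\<^sub>R q \<in> quat_half_space"
    using convexD[OF convex_real_interval(3)[of 0], of "fst p" "fst q" s t]
    by (simp add: quat_half_space_def)
qed

lemma convex_slice_half_plane: "convex (slice_half_plane I)"
proof (rule convexI)
  fix p q :: quat and s t :: real
  assume "p \<in> slice_half_plane I" "q \<in> slice_half_plane I" and st: "0 \<le> s" "0 \<le> t" "s + t = 1"
  then obtain x y x' y' where p: "p = qpoint x y I" "x > 0" and q: "q = qpoint x' y' I" "x' > 0"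
    by (auto simp: slice_half_plane_def)
  have "s *\<^sub>R p + t *\<^sub>R q = qpoint (s * x + t * x') (s * y + t * y') I"
    by (simp add: p q qpoint_def algebra_simps)
  moreover have "s * x + t * x' > 0"
    using convexD[OF convex_real_interval(3)[of 0], of x x' s t] p q st by simp
  ultimately show "s *\<^sub>R p + t *\<^sub>R q \<in> slice_half_plane I"
    by (auto simp: slice_half_plane_def)
qed

lemma h_curve_lengths_nonempty:
  assumes "p \<in> quat_half_space" "q \<in> quat_half_space"
  shows "curve_lengths quat_half_space (\<lambda>u v. sqrt (h_norm_sq u v)) p q \<noteq> {}"
  by (rule curve_lengths_nonempty[OF length_density_h convex_quat_half_space assms])

lemma hyp_curve_lengths_nonempty:
  assumes "I \<in> imag_units" "p \<in> slice_half_plane I" "q \<in> slice_half_plane I"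
  shows "curve_lengths (slice_half_plane I)
    (\<lambda>u v. sqrt (((fst v)\<^sup>2 + (v \<bullet> I)\<^sup>2) / (4 * (fst u)\<^sup>2))) p q \<noteq> {}"
  by (rule curve_lengths_nonempty[OF length_density_hyp[OF assms(1)] convex_slice_half_plane assms(2,3)])

section \<open>The upper bound\<close>

text \<open>The linear map \<open>x + y I0 \<mapsto> x + y I\<close> preserves lengths, since a vector tangent to the slice
  has no component orthogonal to it. The ordinate \<open>y\<close> may be negative: such points lie in the slice
  half plane too, and a curve in it may cross the real axis.\<close>

lemma d_h_slice_le_d_hyp:
  assumes I: "I \<in> imag_units" and I0: "I0 \<in> imag_units" and x: "x1 > 0" "x2 > 0"
  shows "d_h (qpoint x1 y1 I) (qpoint x2 y2 I) \<le> d_hyp I0 (qpoint x1 y1 I0) (qpoint x2 y2 I0)"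
proof -
  define T where "T u = qpoint (fst u) (u \<bullet> I0) I" for u
  have T: "bounded_linear T"
    unfolding T_def qpoint_def by (intro bounded_linear_intros)
  have "d_h (T (qpoint x1 y1 I0)) (T (qpoint x2 y2 I0)) \<le> d_hyp I0 (qpoint x1 y1 I0) (qpoint x2 y2 I0)"
    unfolding d_h_def d_hyp_def
  proof (rule riem_dist_contraction[OF length_density_h, where F' = "\<lambda>u. T"])
    show "curve_lengths (slice_half_plane I0)
        (\<lambda>u v. sqrt (((fst v)\<^sup>2 + (v \<bullet> I0)\<^sup>2) / (4 * (fst u)\<^sup>2))) (qpoint x1 y1 I0) (qpoint x2 y2 I0) \<noteq> {}"
      using x by (intro hyp_curve_lengths_nonempty I0) (auto simp: slice_half_plane_def)
    show "(T has_derivative T) (at u)" for u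
      by (rule bounded_linear_imp_has_derivative[OF T])
    show "continuous_on (slice_half_plane I0 \<times> UNIV) (\<lambda>(u, v). T v)"
      unfolding case_prod_beta T_def qpoint_def by (intro continuous_intros)
  next
    fix u v assume "u \<in> slice_half_plane I0"
    then have u: "fst u > 0"
      using I0 by (auto simp: slice_half_plane_def qpoint_imag_unit)
    then show "T u \<in> quat_half_space"
      using I by (simp add: T_def quat_half_space_def qpoint_imag_unit)
    define x y a b where d: "x = fst u" "y = u \<bullet> I0" "a = fst v" "b = v \<bullet> I0"
    have "x\<^sup>2 + y\<^sup>2 > 0" "x > 0" using u by (simp_all add: d add_pos_nonneg)
    moreover have "h_norm_sq (T u) (T v) =
        (a\<^sup>2 + b\<^sup>2 + (a\<^sup>2 * y\<^sup>2 + (b * y)\<^sup>2) / x\<^sup>2) / (4 * (x\<^sup>2 + y\<^sup>2))"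
      using I u by (simp add: h_norm_sq_formula T_def qpoint_imag_unit imag_units_iff dot_square_norm
          power_mult_distrib mult.commute flip: d)
    moreover have gen: "(A + A * Y / X) / (4 * (X + Y)) = A / (4 * X)" if "X > 0" "X + Y > 0" for A X Y :: real
    proof -
      have "A + A * Y / X = A * (X + Y) / X"
        using that by (simp add: field_simps)
      moreover have "A * Z / X / (4 * Z) = A / (4 * X)" if "Z > 0" for Z
        using that by simp
      ultimately show ?thesis using that by metis
    qed
    ultimately have "h_norm_sq (T u) (T v) = (a\<^sup>2 + b\<^sup>2) / (4 * x\<^sup>2)"
      using gen[of "x\<^sup>2" "y\<^sup>2" "a\<^sup>2 + b\<^sup>2"] by (simp add: power_mult_distrib algebra_simps)
    then show "sqrt (h_norm_sq (T u) (T v)) \<le> sqrt (((fst v)\<^sup>2 + (v \<bullet> I0)\<^sup>2) / (4 * (fst u)\<^sup>2))"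
      by (simp add: d)
  qed
  moreover have "T (qpoint x y I0) = qpoint x y I" for x y
    using I0 by (simp add: T_def qpoint_imag_unit)
  ultimately show ?thesis by simp
qed

text \<open>The dimension bound is for \<open>j = \<plusminus> i\<close>, where \<open>j\<close> does not determine the direction of the
  great circle and any unit vector orthogonal to \<open>i\<close> will do.\<close>

lemma unit_vector_polar:
  fixes i j :: "'a::euclidean_space"
  assumes "norm i = 1" "norm j = 1" "2 \<le> DIM('a)"
  obtains k where "norm k = 1" "i \<bullet> k = 0"
    "j = cos (arccos (i \<bullet> j)) *\<^sub>R i + sin (arccos (i \<bullet> j)) *\<^sub>R k"
proof -
  define c s where cs: "c = i \<bullet> j" "s = sin (arccos c)"
  have c: "\<bar>c\<bar> \<le> 1"
    using Cauchy_Schwarz_ineq2[of i j] assms by (simp add: cs)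
  then have cos: "cos (arccos c) = c"
    by (simp add: cos_arccos_abs)
  have s: "s\<^sup>2 = 1 - c\<^sup>2"
    using sin_cos_squared_add[of "arccos c"] unfolding cs(2) cos by simp
  have ij: "i \<bullet> i = 1" "j \<bullet> j = 1" "i \<bullet> j = c" "j \<bullet> i = c"
    using assms by (simp_all add: norm_eq_1 cs inner_commute)
  have n: "(norm (j - c *\<^sub>R i))\<^sup>2 = s\<^sup>2"
    unfolding power2_norm_eq_inner s by (simp add: inner_diff ij power2_eq_square algebra_simps)
  have polar: "cos (arccos (i \<bullet> j)) = c" "sin (arccos (i \<bullet> j)) = s"
    using cos by (simp_all add: cs)
  show thesis
  proof (cases "s = 0")
    case True
    obtain k where k: "k \<noteq> 0" "orthogonal i k"
      using orthogonal_to_vector_exists[OF assms(3)] by blast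
    show thesis
    proof (rule that[of "sgn k"])
      show "j = cos (arccos (i \<bullet> j)) *\<^sub>R i + sin (arccos (i \<bullet> j)) *\<^sub>R sgn k"
        unfolding polar using n True by simp
    qed (use k in \<open>simp_all add: norm_sgn orthogonal_def sgn_div_norm\<close>)
  next
    case False
    show thesis
    proof (rule that[of "(1/s) *\<^sub>R (j - c *\<^sub>R i)"])
      have "norm (j - c *\<^sub>R i) = \<bar>s\<bar>"
        using n power2_eq_iff_nonneg[of "norm (j - c *\<^sub>R i)" "\<bar>s\<bar>"] by simp
      then show "norm ((1/s) *\<^sub>R (j - c *\<^sub>R i)) = 1"
        using False by simp
      show "i \<bullet> ((1/s) *\<^sub>R (j - c *\<^sub>R i)) = 0"
        by (simp add: inner_diff_right ij)
      show "j = cos (arccos (i \<bullet> j)) *\<^sub>R i + sin (arccos (i \<bullet> j)) *\<^sub>R (1/s) *\<^sub>R (j - c *\<^sub>R i)"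
        unfolding polar using False by simp
    qed
  qed
qed

text \<open>The rotation along a great circle has constant speed \<open>y \<theta> / (2 |q|)\<close>: its velocity is
  orthogonal to the slice, and \<open>|q|\<close> stays the same.\<close>

lemma d_h_rotation_le:
  assumes I: "I \<in> imag_units" and J: "J \<in> imag_units" and x: "0 < x" and y: "0 \<le> y"
  shows "d_h (qpoint x y I) (qpoint x y J) \<le> y / (2 * sqrt (x\<^sup>2 + y\<^sup>2)) * d_sphere I J"
proof -
  define \<theta> where "\<theta> = arccos (snd I \<bullet> snd J)"
  have IJ: "I \<bullet> J = snd I \<bullet> snd J"
    using I J by (simp add: imag_units_iff inner_prod_def)
  have "\<theta> \<ge> 0"
    using Cauchy_Schwarz_ineq2[of "snd I" "snd J"] I J
    by (auto simp: \<theta>_def imag_units_iff abs_le_iff intro!: arccos_lbound)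
  obtain k where k: "norm k = 1" "snd I \<bullet> k = 0" and j: "snd J = cos \<theta> *\<^sub>R snd I + sin \<theta> *\<^sub>R k"
    using unit_vector_polar[of "snd I" "snd J"] I J by (auto simp: imag_units_iff \<theta>_def)
  define e e' where e: "e t = cos (\<theta> * t) *\<^sub>R snd I + sin (\<theta> * t) *\<^sub>R k"
    "e' t = - sin (\<theta> * t) *\<^sub>R snd I + cos (\<theta> * t) *\<^sub>R k" for t
  have ii: "snd I \<bullet> snd I = 1" "k \<bullet> k = 1" "k \<bullet> snd I = 0"
    using I k by (simp_all add: imag_units_iff norm_eq_1 inner_commute)
  have ee: "e t \<bullet> e t = 1" "e' t \<bullet> e' t = 1" "e' t \<bullet> e t = 0" for t
    by (simp_all add: e inner_add_left inner_add_right inner_diff k(2) ii flip: power2_eq_square)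
  have "y * \<theta> / (2 * sqrt (x\<^sup>2 + y\<^sup>2)) \<in> curve_lengths quat_half_space (\<lambda>u v. sqrt (h_norm_sq u v))
      (x, y *\<^sub>R e 0) (x, y *\<^sub>R e 1)"
  proof (rule constant_speed_length[OF length_density_h, where D = "\<lambda>t. (0, (y * \<theta>) *\<^sub>R e' t)"])
    show "((\<lambda>t. (x, y *\<^sub>R e t)) has_vector_derivative (0, (y * \<theta>) *\<^sub>R e' t)) (at t)" for t
      unfolding e by (auto intro!: derivative_eq_intros has_vector_derivative_Pair simp: algebra_simps)
    show "continuous_on {0..1} (\<lambda>t. (0::real, (y * \<theta>) *\<^sub>R e' t))"
      unfolding e by (intro continuous_intros)
    show "(x, y *\<^sub>R e t) \<in> quat_half_space" for t
      using x by (simp add: quat_half_space_def)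
    show "sqrt (h_norm_sq (x, y *\<^sub>R e t) (0, (y * \<theta>) *\<^sub>R e' t)) = y * \<theta> / (2 * sqrt (x\<^sup>2 + y\<^sup>2))" for t
    proof -
      have "norm (e t) = 1" "norm (e' t) = 1" using ee by (simp_all add: norm_eq_1)
      then have "h_norm_sq (x, y *\<^sub>R e t) (0, (y * \<theta>) *\<^sub>R e' t) = (y * \<theta> / (2 * sqrt (x\<^sup>2 + y\<^sup>2)))\<^sup>2"
        using x by (simp add: h_norm_sq_formula norm_prod_def ee power_mult_distrib power_divide)
      then show ?thesis
        using y \<open>\<theta> \<ge> 0\<close> by simp
    qed
  qed
  moreover have "(x, y *\<^sub>R e 0) = qpoint x y I" "(x, y *\<^sub>R e 1) = qpoint x y J"
    using I J j by (simp_all add: prod_eq_iff qpoint_imag_unit e)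
  ultimately have "d_h (qpoint x y I) (qpoint x y J) \<le> y * \<theta> / (2 * sqrt (x\<^sup>2 + y\<^sup>2))"
    unfolding d_h_def using riem_dist_le[OF length_density_h] by simp
  then show ?thesis
    by (simp add: d_sphere_def IJ \<theta>_def)
qed

text \<open>Turning at the first or at the second point gives two bounds, and one of them has the smaller
  of the factors \<open>y / |q|\<close>. The factor \<open>1 / 2\<close> in the cost of a rotation is dropped.\<close>

lemma d_h_le:
  assumes I: "I1 \<in> imag_units" "I2 \<in> imag_units" and I0: "I0 \<in> imag_units"
    and x: "0 < x1" "0 < x2" and y: "0 \<le> y1" "0 \<le> y2"
  defines "q1 \<equiv> qpoint x1 y1 I1" and "q2 \<equiv> qpoint x2 y2 I2"
  shows "d_h q1 q2 \<le> d_hyp I0 (qpoint x1 y1 I0) (qpoint x2 y2 I0)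
    + min (y1 / norm q1) (y2 / norm q2) * d_sphere I1 I2"
proof -
  have tri: "d_h q1 q2 \<le> d_h q1 (qpoint a b J) + d_h (qpoint a b J) q2" if "J \<in> imag_units" "0 < a" for a b J
    unfolding d_h_def using x I that
    by (intro riem_dist_triangle length_density_h h_curve_lengths_nonempty)
      (simp_all add: q1_def q2_def quat_half_space_def qpoint_imag_unit)
  have "\<bar>I1 \<bullet> I2\<bar> \<le> 1"
    using Cauchy_Schwarz_ineq2[of I1 I2] I by (simp add: imag_units_iff norm_prod_def)
  then have s: "0 \<le> d_sphere I1 I2"
    by (auto simp: d_sphere_def abs_le_iff intro: arccos_lbound)
  have half: "y / (2 * norm (qpoint z y J)) * d_sphere I1 I2 \<le> y / norm (qpoint z y J) * d_sphere I1 I2"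
    if "0 \<le> y" for z y J
    using that s by (intro mult_right_mono) (auto simp: divide_simps)
  have "d_h q1 (qpoint x1 y1 I2) \<le> y1 / norm q1 * d_sphere I1 I2"
    using d_h_rotation_le[OF I x(1) y(1)] half[OF y(1), of x1 I1] I
    by (simp add: q1_def qpoint_imag_unit)
  then have 1: "d_h q1 q2 \<le> y1 / norm q1 * d_sphere I1 I2 + d_hyp I0 (qpoint x1 y1 I0) (qpoint x2 y2 I0)"
    using tri[OF I(2) x(1), of y1] d_h_slice_le_d_hyp[OF I(2) I0 x, of y1 y2] by (simp add: q2_def)
  have "d_h (qpoint x2 y2 I1) q2 \<le> y2 / norm q2 * d_sphere I1 I2"
    using d_h_rotation_le[OF I x(2) y(2)] half[OF y(2), of x2 I2] I
    by (simp add: q2_def qpoint_imag_unit)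
  then have 2: "d_h q1 q2 \<le> y2 / norm q2 * d_sphere I1 I2 + d_hyp I0 (qpoint x1 y1 I0) (qpoint x2 y2 I0)"
    using tri[OF I(1) x(2), of y2] d_h_slice_le_d_hyp[OF I(1) I0 x, of y1 y2] by (simp add: q1_def)
  \<comment> \<open>\<open>1\<close> turns at \<open>q1\<close>, and \<open>2\<close> turns at \<open>q2\<close>\<close>
  show ?thesis
    using 1 2 by (simp add: min_def)
qed

section \<open>The hyperbolic term of the lower bound\<close>

text \<open>Vertical segments bound the distance between the projection and its smoothed version.\<close>

lemma d_hyp_vertical_le:
  assumes I: "I \<in> imag_units" and x: "0 < x"
  shows "d_hyp I (qpoint x y I) (qpoint x y' I) \<le> \<bar>y' - y\<bar> / (2 * x)"
proof -
  have "\<bar>y' - y\<bar> / (2 * x) \<in> curve_lengths (slice_half_plane I)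
      (\<lambda>u v. sqrt (((fst v)\<^sup>2 + (v \<bullet> I)\<^sup>2) / (4 * (fst u)\<^sup>2)))
      (qpoint x (y + 0 * (y' - y)) I) (qpoint x (y + 1 * (y' - y)) I)"
  proof (rule constant_speed_length[OF length_density_hyp[OF I], where D = "\<lambda>t. (y' - y) *\<^sub>R I"])
    show "((\<lambda>t. qpoint x (y + t * (y' - y)) I) has_vector_derivative (y' - y) *\<^sub>R I) (at t)" for t
      unfolding qpoint_def by (auto intro!: derivative_eq_intros)
    show "qpoint x (y + t * (y' - y)) I \<in> slice_half_plane I" for t
      using x by (auto simp: slice_half_plane_def)
    have "I \<bullet> I = 1" "fst I = 0"
      using I by (simp_all add: imag_units_iff inner_prod_def dot_square_norm)
    moreover have "(y' - y)\<^sup>2 / (4 * x\<^sup>2) = (\<bar>y' - y\<bar> / (2 * x))\<^sup>2"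
      by (simp add: power_divide power_mult_distrib)
    ultimately show "sqrt (((fst ((y' - y) *\<^sub>R I))\<^sup>2 + ((y' - y) *\<^sub>R I \<bullet> I)\<^sup>2) /
        (4 * (fst (qpoint x (y + t * (y' - y)) I))\<^sup>2)) = \<bar>y' - y\<bar> / (2 * x)" for t
      using x I by (simp add: qpoint_imag_unit del: power_divide)
  qed simp
  then show ?thesis
    unfolding d_hyp_def using riem_dist_le[OF length_density_hyp[OF I]] by simp
qed

text \<open>The projection \<open>\<pi>\<close> with its ordinate \<open>|s|\<close> made smooth at \<open>s = 0\<close>.\<close>

definition smoothed_proj :: "real \<Rightarrow> quat \<Rightarrow> quat \<Rightarrow> quat"
  where "smoothed_proj \<epsilon> I u = qpoint (fst u) (sqrt (snd u \<bullet> snd u + \<epsilon>\<^sup>2)) I"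

text \<open>With \<open>u = (x, s)\<close> and \<open>v = (a, b)\<close>, the ordinate of the smoothed projection has derivative
  \<open>(b \<bullet> s) / sqrt (|s|\<^sup>2 + \<epsilon>\<^sup>2)\<close>. This is at most the radial part of \<open>b\<close> in absolute value, and
  \<open>h\<close> measures the radial part with the hyperbolic factor \<open>1 / (4 x\<^sup>2)\<close>.\<close>

lemma d_hyp_smoothed_proj_le:
  assumes I: "I \<in> imag_units" and "0 < \<epsilon>" and pq: "p \<in> quat_half_space" "q \<in> quat_half_space"
  shows "d_hyp I (smoothed_proj \<epsilon> I p) (smoothed_proj \<epsilon> I q) \<le> d_h p q"
proof -
  define \<rho> where "\<rho> u = sqrt (snd u \<bullet> snd u + \<epsilon>\<^sup>2)" for u :: quat
  have pos: "snd u \<bullet> snd u + \<epsilon>\<^sup>2 > 0" for u :: quat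
    using \<open>0 < \<epsilon>\<close> by (simp add: add_nonneg_pos)
  define F' where "F' u v = qpoint (fst v) ((snd v \<bullet> snd u) / \<rho> u) I" for u v :: quat
  show ?thesis
    unfolding d_h_def d_hyp_def
  proof (rule riem_dist_contraction[OF length_density_hyp[OF I] h_curve_lengths_nonempty[OF pq],
        where F' = F'])
    fix u v :: quat assume "u \<in> quat_half_space"
    then have x: "fst u > 0" by (simp add: quat_half_space_def)
    show "(smoothed_proj \<epsilon> I has_derivative F' u) (at u)"
      unfolding smoothed_proj_def F'_def qpoint_def \<rho>_def using pos[of u]
      by (auto intro!: derivative_eq_intros simp: fun_eq_iff divide_simps inner_commute)
    show "smoothed_proj \<epsilon> I u \<in> slice_half_plane I"
      using x by (auto simp: slice_half_plane_def smoothed_proj_def)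
    define Y B m k where d: "Y = (norm (snd u))\<^sup>2" "B = (norm (snd v))\<^sup>2"
      "m = (snd v \<bullet> snd u)\<^sup>2" "k = m / (Y + \<epsilon>\<^sup>2)"
    have nn: "0 \<le> Y" "0 \<le> B" "0 \<le> m" "0 < Y + \<epsilon>\<^sup>2" "0 \<le> k"
      using pos[of u] by (simp_all add: d dot_square_norm)
    have m: "m \<le> B * Y"
      using Cauchy_Schwarz_ineq[of "snd v" "snd u"] by (simp add: d dot_square_norm)
    have kB: "k \<le> B"
      using nn add_mono[OF m mult_nonneg_nonneg[OF nn(2) zero_le_power2[of \<epsilon>]]]
      by (simp add: d(4) divide_le_eq distrib_left)
    have kY: "k * Y \<le> m"
      using nn mult_nonneg_nonneg[OF nn(3), of "\<epsilon>\<^sup>2"]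
      by (simp add: d(4) divide_le_eq distrib_left)
    \<comment> \<open>\<open>k \<le> B\<close> is used for the part \<open>|x|\<^sup>2\<close> of \<open>|u|\<^sup>2\<close>, and \<open>k Y \<le> m\<close> for the part \<open>|s|\<^sup>2\<close>\<close>
    have "(a + k) / (4 * X) \<le> (a + B + (a * Y + m) / X) / (4 * (X + Y))" if X: "X > 0" for X a :: real
    proof -
      have "(a + k) * (X + Y) \<le> (a + B) * X + (a * Y + m)"
        using add_mono[OF kY mult_right_mono[OF kB, of X]] X by (simp add: algebra_simps)
      then have "(a + k) * (X + Y) / (4 * X * (X + Y)) \<le> ((a + B) * X + (a * Y + m)) / (4 * X * (X + Y))"
        using X nn by (intro divide_right_mono) auto
      moreover have "((a + B) * X + (a * Y + m)) / (4 * X * (X + Y)) = (a + B + (a * Y + m) / X) / (4 * (X + Y))"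
      proof -
        have "(a + B) * X + (a * Y + m) = X * (a + B + (a * Y + m) / X)"
          using X by (simp add: field_simps)
        moreover have "X * N / (4 * X * Z) = N / (4 * Z)" for N Z
          using X by simp
        ultimately show ?thesis by metis
      qed
      ultimately show ?thesis
        using X nn by simp
    qed
    from this[of "(fst u)\<^sup>2" "(fst v)\<^sup>2"]
    have "((fst v)\<^sup>2 + k) / (4 * (fst u)\<^sup>2) \<le> h_norm_sq u v"
      using x nn by (simp add: h_norm_sq_formula norm_prod_def flip: d)
    moreover have "(F' u v \<bullet> I)\<^sup>2 = k" "fst (F' u v) = fst v" "fst (smoothed_proj \<epsilon> I u) = fst u"
      using I pos[of u]
      by (simp_all add: F'_def smoothed_proj_def qpoint_imag_unit \<rho>_def d power_divide dot_square_norm)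
    ultimately show "sqrt (((fst (F' u v))\<^sup>2 + (F' u v \<bullet> I)\<^sup>2) / (4 * (fst (smoothed_proj \<epsilon> I u))\<^sup>2))
        \<le> sqrt (h_norm_sq u v)"
      by simp
  next
    show "continuous_on (quat_half_space \<times> UNIV) (\<lambda>(u, v). F' u v)"
      unfolding F'_def case_prod_beta qpoint_def \<rho>_def using pos
      by (intro continuous_intros) (auto simp: less_imp_neq[symmetric])
  qed
qed

text \<open>The smoothing moves the ordinate by at most \<open>\<epsilon>\<close>, hence the projected points by at most
  \<open>\<epsilon> / (2 x)\<close> in the hyperbolic distance; this tends to \<open>0\<close>.\<close>

lemma d_hyp_proj_le_d_h:
  assumes I: "I \<in> imag_units" and p: "p \<in> quat_half_space" and q: "q \<in> quat_half_space"
  shows "d_hyp I (slice_proj I p) (slice_proj I q) \<le> d_h p q"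
proof (rule field_le_epsilon)
  fix e :: real assume "0 < e"
  have x: "0 < fst p" "0 < fst q"
    using p q by (simp_all add: quat_half_space_def)
  \<comment> \<open>\<open>\<epsilon> c\<close> is the total cost of the two vertical segments\<close>
  define c where "c = 1 / (2 * fst p) + 1 / (2 * fst q)"
  define \<epsilon> where "\<epsilon> = e / c"
  have "c > 0" using x by (simp add: c_def add_pos_pos)
  then have \<epsilon>: "\<epsilon> > 0" "\<epsilon> * c = e" using \<open>0 < e\<close> by (simp_all add: \<epsilon>_def)
  have slice: "slice_proj I u \<in> slice_half_plane I" "smoothed_proj \<epsilon> I u \<in> slice_half_plane I"
    if "0 < fst u" for u
    using that by (auto simp: slice_half_plane_def slice_proj_def smoothed_proj_def)
  have tri: "d_hyp I a c \<le> d_hyp I a b + d_hyp I b c"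
    if "a \<in> slice_half_plane I" "b \<in> slice_half_plane I" "c \<in> slice_half_plane I" for a b c
    unfolding d_hyp_def using that
    by (intro riem_dist_triangle length_density_hyp hyp_curve_lengths_nonempty I)
  have gap: "\<bar>sqrt (snd u \<bullet> snd u + \<epsilon>\<^sup>2) - norm (snd u)\<bar> \<le> \<epsilon>" for u :: quat
  proof -
    have "norm (snd u) \<le> sqrt (snd u \<bullet> snd u + \<epsilon>\<^sup>2)"
      by (intro real_le_rsqrt) (simp add: dot_square_norm)
    moreover have "sqrt (snd u \<bullet> snd u + \<epsilon>\<^sup>2) \<le> norm (snd u) + \<epsilon>"
      using \<epsilon> sqrt_sum_squares_le_sum[of "norm (snd u)" \<epsilon>] by (simp add: dot_square_norm)
    ultimately show ?thesis by simp
  qed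
  have "d_hyp I (slice_proj I p) (slice_proj I q) \<le> d_hyp I (slice_proj I p) (smoothed_proj \<epsilon> I p)
      + (d_hyp I (smoothed_proj \<epsilon> I p) (smoothed_proj \<epsilon> I q) + d_hyp I (smoothed_proj \<epsilon> I q) (slice_proj I q))"
    using tri[of "slice_proj I p" "smoothed_proj \<epsilon> I p" "slice_proj I q"]
      tri[of "smoothed_proj \<epsilon> I p" "smoothed_proj \<epsilon> I q" "slice_proj I q"] slice x by fastforce
  moreover have "d_hyp I (slice_proj I p) (smoothed_proj \<epsilon> I p) \<le> \<epsilon> / (2 * fst p)"
    unfolding slice_proj_def smoothed_proj_def
    by (rule order_trans[OF d_hyp_vertical_le[OF I x(1)]]) (use x gap in \<open>auto intro!: divide_right_mono\<close>)
  moreover have "d_hyp I (smoothed_proj \<epsilon> I q) (slice_proj I q) \<le> \<epsilon> / (2 * fst q)"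
    unfolding slice_proj_def smoothed_proj_def
    by (rule order_trans[OF d_hyp_vertical_le[OF I x(2)]])
      (use x gap in \<open>auto intro!: divide_right_mono simp: abs_minus_commute\<close>)
  moreover have "d_hyp I (smoothed_proj \<epsilon> I p) (smoothed_proj \<epsilon> I q) \<le> d_h p q"
    by (rule d_hyp_smoothed_proj_le[OF I \<epsilon>(1) p q])
  moreover have "\<epsilon> / (2 * fst p) + \<epsilon> / (2 * fst q) = e"
    unfolding \<epsilon>(2)[symmetric] c_def by (simp add: distrib_left)
  ultimately show "d_hyp I (slice_proj I p) (slice_proj I q) \<le> d_h p q + e"
    by linarith
qed

section \<open>The spherical term of the lower bound\<close>

lemma concave_on_sin: "concave_on {0..pi} (sin :: real \<Rightarrow> real)"
proof (rule f''_le0_imp_concave)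
  show "(sin has_real_derivative cos x) (at x)" "(cos has_real_derivative - sin x) (at x)" for x :: real
    by (auto intro!: derivative_eq_intros)
  show "- sin x \<le> 0" if "x \<in> {0..pi}" for x :: real
    using that by (simp add: sin_ge_zero)
qed simp

text \<open>A chord of angle \<open>\<theta>\<close> has length \<open>2 sin (\<theta> / 2)\<close>, and the concave function \<open>sin\<close> lies above
  the segment from \<open>(0, 0)\<close> to \<open>(\<pi> / 2, 1)\<close>.\<close>

lemma angle_le_chord:
  fixes i j :: "'a::real_inner"
  assumes "norm i = 1" "norm j = 1"
  shows "2 / pi * arccos (i \<bullet> j) \<le> norm (i - j)"
proof -
  define \<theta> where "\<theta> = arccos (i \<bullet> j)"
  have c: "\<bar>i \<bullet> j\<bar> \<le> 1"
    using Cauchy_Schwarz_ineq2[of i j] assms by simp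
  then have \<theta>: "0 \<le> \<theta>" "\<theta> \<le> pi" "cos \<theta> = i \<bullet> j"
    by (auto simp: \<theta>_def cos_arccos_abs abs_le_iff intro: arccos_lbound arccos_ubound)
  have "(norm (i - j))\<^sup>2 = 2 - 2 * cos \<theta>"
    using assms unfolding power2_norm_eq_inner by (simp add: inner_diff norm_eq_1 inner_commute \<theta>)
  also have "\<dots> = (2 * sin (\<theta> / 2))\<^sup>2"
    using cos_double_sin[of "\<theta> / 2"] by (simp add: power_mult_distrib)
  finally have sq: "(norm (i - j))\<^sup>2 = (2 * sin (\<theta> / 2))\<^sup>2" .
  have "norm (i - j) = 2 * sin (\<theta> / 2)"
    by (rule power2_eq_imp_eq[OF sq]) (use \<theta> in \<open>simp_all add: sin_ge_zero\<close>)
  moreover have "\<theta> / pi \<le> sin (\<theta> / 2)"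
  proof -
    have "(1 - \<theta> / pi) * sin 0 + \<theta> / pi * sin (pi / 2) \<le> sin ((1 - \<theta> / pi) *\<^sub>R 0 + (\<theta> / pi) *\<^sub>R (pi / 2))"
      using \<theta> by (intro concave_onD[OF concave_on_sin]) auto
    then show ?thesis by simp
  qed
  ultimately show ?thesis
    by (simp add: \<theta>_def)
qed

text \<open>Two points in the directions \<open>i\<close> and \<open>j\<close> at distance at least \<open>r\<close> from the origin are not
  nearer to each other than \<open>r i\<close> and \<open>r j\<close>, by
  \<open>|r1 i - r2 j|\<^sup>2 = (r1 - r2)\<^sup>2 + r1 r2 |i - j|\<^sup>2\<close>.\<close>

lemma min_mult_chord_le:
  fixes i j :: "'a::real_inner"
  assumes "norm i = 1" "norm j = 1" "0 \<le> r" "r \<le> r1" "r \<le> r2"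
  shows "r * norm (i - j) \<le> norm (r1 *\<^sub>R i - r2 *\<^sub>R j)"
proof (rule power2_le_imp_le)
  have "i \<bullet> i = 1" "j \<bullet> j = 1" using assms by (simp_all add: norm_eq_1)
  then have 1: "(norm (i - j))\<^sup>2 = 2 - 2 * (i \<bullet> j)"
    and 2: "(norm (r1 *\<^sub>R i - r2 *\<^sub>R j))\<^sup>2 = (r1 - r2)\<^sup>2 + r1 * r2 * (2 - 2 * (i \<bullet> j))"
    unfolding power2_norm_eq_inner
    by (simp_all add: inner_diff inner_commute power2_eq_square algebra_simps)
  have "r\<^sup>2 * (2 - 2 * (i \<bullet> j)) \<le> r1 * r2 * (2 - 2 * (i \<bullet> j))"
    unfolding power2_eq_square using assms 1[symmetric] by (intro mult_right_mono mult_mono) auto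
  then show "(r * norm (i - j))\<^sup>2 \<le> (norm (r1 *\<^sub>R i - r2 *\<^sub>R j))\<^sup>2"
    unfolding power_mult_distrib 1 2 by (smt (verit) zero_le_power2)
qed simp

lemma sgn_has_derivative:
  fixes u :: "'a::real_inner"
  assumes "u \<noteq> 0"
  shows "(sgn has_derivative (\<lambda>v. inverse (norm u) *\<^sub>R (v - (v \<bullet> sgn u) *\<^sub>R sgn u))) (at u)"
proof -
  have "((\<lambda>u. inverse (norm u) *\<^sub>R u) has_derivative
      (\<lambda>v. inverse (norm u) *\<^sub>R (v - (v \<bullet> sgn u) *\<^sub>R sgn u))) (at u)"
    using assms
    by (auto intro!: derivative_eq_intros has_derivative_norm
        simp: sgn_div_norm fun_eq_iff algebra_simps)
  then show ?thesis
    by (simp add: sgn_div_norm[abs_def])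
qed

lemma norm_orthogonal_part_le:
  fixes v w :: "'a::real_inner"
  assumes "norm w = 1"
  shows "norm (v - (v \<bullet> w) *\<^sub>R w) \<le> norm v"
proof (rule power2_le_imp_le)
  define c where "c = v \<bullet> w"
  have w: "w \<bullet> w = 1" "v \<bullet> w = c" "w \<bullet> v = c"
    using assms by (simp_all add: c_def dot_square_norm inner_commute)
  have "(norm (v - c *\<^sub>R w))\<^sup>2 = (norm v)\<^sup>2 - c\<^sup>2"
    unfolding power2_norm_eq_inner by (simp add: inner_diff w power2_eq_square)
  then show "(norm (v - (v \<bullet> w) *\<^sub>R w))\<^sup>2 \<le> (norm v)\<^sup>2"
    by (simp add: w)
qed simp

text \<open>The derivative of \<open>sgn\<close> at \<open>u\<close> removes the radial part of \<open>v\<close> and divides by \<open>|u|\<close>, so its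
  norm is at most \<open>|v| / |u|\<close>, twice a lower bound of the length of \<open>v\<close> in \<open>h\<close>. The half of
  the Euclidean metric on the target turns this estimate into a contraction.\<close>

lemma direction_distance_le_d_h:
  assumes pq: "p \<in> quat_half_space" "q \<in> quat_half_space"
  shows "1 / 2 * norm (sgn q - sgn p) \<le> d_h p q"
proof -
  define F' where "F' u v = inverse (norm u) *\<^sub>R (v - (v \<bullet> sgn u) *\<^sub>R sgn u)" for u v :: quat
  have dens: "length_density UNIV (\<lambda>u v. 1 / 2 * norm v)"
    unfolding length_density_def case_prod_beta by (auto intro!: continuous_intros)
  have "1 / 2 * norm (sgn q - sgn p) \<le> riem_dist UNIV (\<lambda>u v. 1 / 2 * norm v) (sgn p) (sgn q)"
  proof (rule riem_dist_greatest)
    show "curve_lengths UNIV (\<lambda>u v. 1 / 2 * norm v) (sgn p) (sgn q) \<noteq> {}"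
      by (rule curve_lengths_nonempty[OF dens]) simp_all
  qed (rule displacement_le_length, assumption, simp)
  also have "\<dots> \<le> d_h p q"
    unfolding d_h_def
  proof (rule riem_dist_contraction[OF dens h_curve_lengths_nonempty[OF pq], where F' = F'])
    fix u v :: quat assume u: "u \<in> quat_half_space"
    then have u0: "u \<noteq> 0" by (auto simp: quat_half_space_def)
    show "(sgn has_derivative F' u) (at u)"
      unfolding F'_def by (rule sgn_has_derivative[OF u0])
    have "norm (v - (v \<bullet> sgn u) *\<^sub>R sgn u) \<le> norm v"
      using u0 by (intro norm_orthogonal_part_le) (simp add: norm_sgn)
    then have "1 / 2 * norm (F' u v) \<le> norm v / (2 * norm u)"
      using u0 by (simp add: F'_def divide_simps)
    also have "\<dots> \<le> sqrt (h_norm_sq u v)"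
    proof (rule real_le_rsqrt)
      show "(norm v / (2 * norm u))\<^sup>2 \<le> h_norm_sq u v"
        using u by (auto simp: quat_half_space_def h_norm_sq_formula power_divide power_mult_distrib
            intro!: divide_right_mono)
    qed
    finally show "1 / 2 * norm (F' u v) \<le> sqrt (h_norm_sq u v)" .
  next
    show "continuous_on (quat_half_space \<times> UNIV) (\<lambda>(u, v). F' u v)"
      unfolding F'_def case_prod_beta sgn_div_norm
      by (intro continuous_intros) (auto simp: quat_half_space_def zero_prod_def)
  qed simp
  finally show ?thesis .
qed

text \<open>The factor \<open>\<pi>\<close> is the product of the Lipschitz constant \<open>2\<close> of \<open>sgn\<close> and the ratio \<open>\<pi> / 2\<close>
  between angle and chord.\<close>

lemma spherical_term_le_d_h:
  assumes I: "I1 \<in> imag_units" "I2 \<in> imag_units" and x: "0 < x1" "0 < x2" and y: "0 \<le> y1" "0 \<le> y2"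
  defines "q1 \<equiv> qpoint x1 y1 I1" and "q2 \<equiv> qpoint x2 y2 I2"
  shows "min (y1 / norm q1) (y2 / norm q2) * d_sphere I1 I2 \<le> pi * d_h q1 q2"
proof -
  define r where "r = min (y1 / norm q1) (y2 / norm q2)"
  have r: "0 \<le> r" using y by (simp add: r_def)
  have i: "norm (snd I1) = 1" "norm (snd I2) = 1" "d_sphere I1 I2 = arccos (snd I1 \<bullet> snd I2)"
    using I by (simp_all add: imag_units_iff d_sphere_def inner_prod_def)
  have q: "q1 \<in> quat_half_space" "q2 \<in> quat_half_space"
    using I x by (simp_all add: q1_def q2_def quat_half_space_def qpoint_imag_unit)
  have "r * (2 / pi * d_sphere I1 I2) \<le> r * norm (snd I1 - snd I2)"
    unfolding i(3) by (rule mult_left_mono[OF angle_le_chord[OF i(1,2)] r])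
  also have "\<dots> \<le> norm ((y1 / norm q1) *\<^sub>R snd I1 - (y2 / norm q2) *\<^sub>R snd I2)"
    by (rule min_mult_chord_le[OF i(1,2) r]) (simp_all add: r_def)
  also have "\<dots> = norm (snd (sgn q1 - sgn q2))"
    using I by (simp add: sgn_div_norm q1_def q2_def qpoint_imag_unit(2) divide_inverse mult.commute)
  also have "\<dots> \<le> norm (sgn q2 - sgn q1)"
    by (metis norm_minus_commute norm_snd_le snd_def prod.collapse)
  also have "\<dots> \<le> 2 * d_h q1 q2"
    using direction_distance_le_d_h[OF q] by simp
  finally show ?thesis
    by (simp add: r_def field_simps)
qed

section \<open>The comparison theorem\<close>

theorem theorem5p2:
  fixes I0 :: quat
  assumes "I0 \<in> imag_units"
  shows "\<exists>C1 C2 :: real. 0 < C1 \<and> C1 \<le> C2 \<and>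
    (\<forall>x1 y1 x2 y2 :: real. \<forall>I1 \<in> imag_units. \<forall>I2 \<in> imag_units.
      x1 > 0 \<longrightarrow> y1 \<ge> 0 \<longrightarrow> x2 > 0 \<longrightarrow> y2 \<ge> 0 \<longrightarrow>
      (let q1 = qpoint x1 y1 I1; q2 = qpoint x2 y2 I2;
           E = d_hyp I0 (slice_proj I0 q1) (slice_proj I0 q2)
             + min (y1 / norm q1) (y2 / norm q2) * d_sphere I1 I2
       in C1 * E \<le> d_h q1 q2 \<and> d_h q1 q2 \<le> C2 * E))"
proof (intro exI conjI allI ballI impI)
  show "0 < 1 / (1 + pi)" "1 / (1 + pi) \<le> 1"
    using pi_gt_zero by (simp_all add: add_pos_pos)
next
  fix x1 y1 x2 y2 :: real and I1 I2
  assume I: "I1 \<in> imag_units" "I2 \<in> imag_units" and xy: "x1 > 0" "y1 \<ge> 0" "x2 > 0" "y2 \<ge> 0"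
  define q1 q2 where q: "q1 = qpoint x1 y1 I1" "q2 = qpoint x2 y2 I2"
  define E where "E = d_hyp I0 (slice_proj I0 q1) (slice_proj I0 q2)
    + min (y1 / norm q1) (y2 / norm q2) * d_sphere I1 I2"
  have "q1 \<in> quat_half_space" "q2 \<in> quat_half_space"
    using I xy by (simp_all add: q quat_half_space_def qpoint_imag_unit)
  then have "E \<le> (1 + pi) * d_h q1 q2"
    using d_hyp_proj_le_d_h[OF assms] spherical_term_le_d_h[OF I xy(1,3,2,4)]
    unfolding E_def q distrib_right by (intro add_mono) simp_all
  then have "1 / (1 + pi) * E \<le> d_h q1 q2"
    using pi_gt_zero by (simp add: divide_le_eq add_pos_pos mult.commute)
  moreover have "d_h q1 q2 \<le> 1 * E"
    using d_h_le[OF I assms xy(1,3,2,4)] I xy by (simp add: E_def q slice_proj_qpoint)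
  ultimately show "let q1 = qpoint x1 y1 I1; q2 = qpoint x2 y2 I2;
      E = d_hyp I0 (slice_proj I0 q1) (slice_proj I0 q2)
        + min (y1 / norm q1) (y2 / norm q2) * d_sphere I1 I2
    in 1 / (1 + pi) * E \<le> d_h q1 q2 \<and> d_h q1 q2 \<le> 1 * E"
    unfolding Let_def E_def q by blast
qed

end
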